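(* Let $\omega=e^{2\pi i/3}$ and let $$H=\begin{pmatrix}1&1&1&1&1&1\\1&\omega&\omega^2&1&\omega&\omega^2\\1&\omega^2&\omega&\omega&1&\omega^2\\1&1&1&-1&-1&-1\\1&\omega&\omega^2&-1&-\omega&-\omega^2\\1&\omega^2&\omega&-\omega&-1&-\omega^2\end{pmatrix}.$$ Let $P$ be the $6\times 6$ permutation matrix such that $PH$ is obtained from $H$ by exchanging the first two rows and fixing the remaining rows, and set $K=PH$. Let $h_0,\dots,h_5$ and $k_0,\dots,k_5$ be the columns of $H$ and $K$, respectively, and let $\Phi_{27}$ be the $6\times 6$ array of vectors with $(i,j)$ entry $\frac{1}{\sqrt6}(h_i\odot k_j)\in\mathbb{C}^6$, $0\le i,j\le5$. Then $\Phi_{27}$ is a quantum Latin square of order $6$ and its cardinality is $27$.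
   Context: For $x,y\in\mathbb{C}^n$, $x\odot y=(x_0y_0,\dots,x_{n-1}y_{n-1})^{\mathsf T}$ is the entrywise (Schur) product. A quantum Latin square of order $n$, denoted $\mathrm{QLS}(n)$, is an $n\times n$ array $(\phi_{ij})_{0\le i,j\le n-1}$ of unit vectors in $\mathbb{C}^n$ such that every row and every column forms an orthonormal basis of $\mathbb{C}^n$. Two unit vectors $u,v$ are phase equivalent, $u\sim v$, if $u=e^{i\alpha}v$ for some $\alpha\in\mathbb{R}$. The cardinality of a quantum Latin square is the number of distinct phase-equivalence classes among its $n^2$ entries. *)

theory Defs
  imports
    Complex_Main
    "Jordan_Normal_Form.VS_Connect"
    "Jordan_Normal_Form.Gauss_Jordan_Elimination"
begin

definition schur_prod :: "'a :: times vec \<Rightarrow> 'a vec \<Rightarrow> 'a vec" (infixl "\<odot>" 70) where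
  "x \<odot> y = vec (dim_vec x) (\<lambda>i. x $ i * y $ i)"

(* The library's Hermitian product (\<bullet>c) is conjugate-linear in the second argument. *)
definition unit_sphere :: "nat \<Rightarrow> complex vec set" where
  "unit_sphere n = {v \<in> carrier_vec n. v \<bullet>c v = 1}"

(* Stated for families, so that repeated vectors are excluded. *)
definition orthonormal_basis :: "nat \<Rightarrow> (nat \<Rightarrow> complex vec) \<Rightarrow> bool" where
  "orthonormal_basis n f \<longleftrightarrow>
     (\<forall>i<n. f i \<in> unit_sphere n) \<and>
     (\<forall>i<n. \<forall>j<n. i \<noteq> j \<longrightarrow> f i \<bullet>c f j = 0) \<and>
     vectorspace.basis class_ring (module_vec TYPE(complex) n) (f ` {..<n})"

(* Only the entries with both indices below n are relevant in an array of order n. *)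
definition quantum_latin_square :: "nat \<Rightarrow> (nat \<Rightarrow> nat \<Rightarrow> complex vec) \<Rightarrow> bool" where
  "quantum_latin_square n \<phi> \<longleftrightarrow>
     (\<forall>i<n. \<forall>j<n. \<phi> i j \<in> unit_sphere n) \<and>
     (\<forall>i<n. orthonormal_basis n (\<lambda>j. \<phi> i j)) \<and>
     (\<forall>j<n. orthonormal_basis n (\<lambda>i. \<phi> i j))"

definition phase_rel :: "nat \<Rightarrow> (complex vec \<times> complex vec) set" where
  "phase_rel n = {(u, v). u \<in> unit_sphere n \<and> v \<in> unit_sphere n \<and>
     (\<exists>\<alpha>::real. u = exp (\<i> * complex_of_real \<alpha>) \<cdot>\<^sub>v v)}"

lemma equiv_phase_rel: "equiv (unit_sphere n) (phase_rel n)"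
proof (rule equivI)
  show "phase_rel n \<subseteq> unit_sphere n \<times> unit_sphere n"
    by (auto simp: phase_rel_def)
  show "refl_on (unit_sphere n) (phase_rel n)"
    by (auto simp: refl_on_def phase_rel_def intro!: exI[of _ 0])
  show "sym (phase_rel n)"
  proof (rule symI)
    fix u v assume "(u, v) \<in> phase_rel n"
    then obtain \<alpha> :: real where uv: "u \<in> unit_sphere n" "v \<in> unit_sphere n"
      and u: "u = exp (\<i> * complex_of_real \<alpha>) \<cdot>\<^sub>v v"
      by (auto simp: phase_rel_def)
    have "v = exp (\<i> * complex_of_real (- \<alpha>)) \<cdot>\<^sub>v u"
      by (simp add: u smult_smult_assoc exp_add[symmetric])
    with uv show "(v, u) \<in> phase_rel n" unfolding phase_rel_def by blast
  qed
  show "trans (phase_rel n)"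
  proof (rule transI)
    fix u v w assume "(u, v) \<in> phase_rel n" "(v, w) \<in> phase_rel n"
    then obtain \<alpha> \<beta> :: real where uw: "u \<in> unit_sphere n" "w \<in> unit_sphere n"
      and u: "u = exp (\<i> * complex_of_real \<alpha>) \<cdot>\<^sub>v v"
      and v: "v = exp (\<i> * complex_of_real \<beta>) \<cdot>\<^sub>v w"
      by (auto simp: phase_rel_def)
    have "u = exp (\<i> * complex_of_real (\<alpha> + \<beta>)) \<cdot>\<^sub>v w"
      by (simp add: u v smult_smult_assoc exp_add[symmetric] distrib_left)
    with uw show "(u, w) \<in> phase_rel n" unfolding phase_rel_def by blast
  qed
qed

definition qls_cardinality :: "nat \<Rightarrow> (nat \<Rightarrow> nat \<Rightarrow> complex vec) \<Rightarrow> nat" where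
  "qls_cardinality n \<phi> = card ({\<phi> i j | i j. i < n \<and> j < n} // phase_rel n)"

definition omega :: complex where
  "omega = exp (2 * complex_of_real pi * \<i> / 3)"

definition H6 :: "complex mat" where
  "H6 = mat_of_rows_list 6
    [[1, 1,       1,       1,        1,        1],
     [1, omega,   omega^2, 1,        omega,    omega^2],
     [1, omega^2, omega,   omega,    1,        omega^2],
     [1, 1,       1,       - 1,      - 1,      - 1],
     [1, omega,   omega^2, - 1,      - omega,  - (omega^2)],
     [1, omega^2, omega,   - omega,  - 1,      - (omega^2)]]"

definition P6 :: "complex mat" where
  "P6 = swaprows_mat 6 0 1"

definition K6 :: "complex mat" where
  "K6 = P6 * H6"

lemma H6_carrier: "H6 \<in> carrier_mat 6 6"
  by (rule carrier_matI) (simp_all add: H6_def mat_of_rows_list_def)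

lemma P6_mult_H6: "P6 * H6 = swaprows 0 1 H6"
  unfolding P6_def by (rule swaprows_mat[OF H6_carrier, symmetric]) simp_all

definition Phi27 :: "nat \<Rightarrow> nat \<Rightarrow> complex vec" where
  "Phi27 i j = complex_of_real (1 / sqrt 6) \<cdot>\<^sub>v (col H6 i \<odot> col K6 j)"

end

theory Submission
  imports Defs
begin

text \<open>
  All entries of \<open>H\<close> are sixth roots of unity and the columns of \<open>H\<close>, hence those of \<open>K\<close>, are
  pairwise orthogonal. Since the entries are unimodular, \<open>h\<^sub>i \<odot> k\<^sub>j\<close> and \<open>h\<^sub>i \<odot> k\<^sub>j\<^sub>'\<close> have the same
  inner product as \<open>k\<^sub>j\<close> and \<open>k\<^sub>j\<^sub>'\<close>, and symmetrically for columns of the array; this gives the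
  quantum Latin square. Dividing a vector of sixth roots of unity by its first entry yields a
  complete invariant of its phase class, which in terms of exponents is a word over the integers
  modulo 6, so the cardinality is found by counting the words that arise.
\<close>

section \<open>Orthonormal bases and counting of classes\<close>

text \<open>Orthonormality says that the matrix with rows \<open>conjugate (f i)\<close> is a left
  inverse of the matrix with columns \<open>f i\<close>. The latter thus has nonzero determinant, so
  its n distinct columns are independent and form a basis by dimension.\<close>

lemma orthonormal_basisI:
  assumes unit: "\<And>i. i < n \<Longrightarrow> f i \<in> unit_sphere n"
    and orth: "\<And>i j. i < n \<Longrightarrow> j < n \<Longrightarrow> i \<noteq> j \<Longrightarrow> f i \<bullet>c f j = 0"
  shows "orthonormal_basis n f"
proof -
  interpret vec_space "TYPE(complex)" n .
  define A where "A = mat_of_cols n (map f [0..<n])"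
  define B where "B = mat_of_rows n (map (\<lambda>i. conjugate (f i)) [0..<n])"
  have f: "f i \<in> carrier_vec n" if "i < n" for i
    using unit[OF that] by (simp add: unit_sphere_def)
  have A: "A \<in> carrier_mat n n" and B: "B \<in> carrier_mat n n"
    by (auto simp: A_def B_def)
  have cols: "cols A = map f [0..<n]"
    unfolding A_def using f by (intro cols_mat_of_cols) auto
  have ip: "f i \<bullet>c f j = (if i = j then 1 else 0)" if "i < n" "j < n" for i j
    using unit[OF that(1)] orth[OF that] by (auto simp: unit_sphere_def)
  have "B * A = 1\<^sub>m n"
  proof (rule eq_matI)
    fix i j assume ij: "i < dim_row (1\<^sub>m n :: complex mat)" "j < dim_col (1\<^sub>m n :: complex mat)"
    then have ij': "i < n" "j < n" by auto
    have "row B i = conjugate (f i)"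
      unfolding B_def using f ij' by (subst mat_of_rows_row) auto
    moreover have "col A j = f j"
      unfolding A_def using f ij' by (subst col_mat_of_cols) auto
    ultimately have "(B * A) $$ (i, j) = f j \<bullet>c f i"
      using A B ij' f by (simp add: comm_scalar_prod[of _ n])
    then show "(B * A) $$ (i, j) = 1\<^sub>m n $$ (i, j)"
      using ip ij' by simp
  qed (use A B in auto)
  then have "det B * det A = 1"
    using det_mult[OF B A] by simp
  then have "det A \<noteq> 0" by auto
  then have "lin_indpt (set (cols A))"
    using lin_dep_cols_imp_det_0[OF A] by blast
  then have li: "lin_indpt (f ` {..<n})"
    by (simp add: cols atLeast0LessThan)
  have "inj_on f {..<n}"
  proof (rule inj_onI)
    fix i j assume "i \<in> {..<n}" "j \<in> {..<n}" "f i = f j"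
    then show "i = j" using ip[of i j] ip[of i i] by (auto split: if_splits)
  qed
  then have "card (f ` {..<n}) = n" by (simp add: card_image)
  then have "basis (f ` {..<n})"
    using li f by (intro dim_li_is_basis) (auto simp: dim_is_n)
  then show ?thesis
    using unit orth by (simp add: orthonormal_basis_def)
qed

lemma card_quotient_image:
  assumes R: "equiv S R" and f: "f ` I \<subseteq> S"
    and inv: "\<And>p q. p \<in> I \<Longrightarrow> q \<in> I \<Longrightarrow> (f p, f q) \<in> R \<longleftrightarrow> c p = c q"
  shows "card ((f ` I) // R) = card (c ` I)"
proof -
  have eq: "R `` {f p} = R `` {f q} \<longleftrightarrow> c p = c q" if "p \<in> I" "q \<in> I" for p q
    using eq_equiv_class_iff[OF R, of "f p" "f q"] inv that f by blast
  \<comment> \<open>A representative of each value of \<open>c\<close> is chosen; by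
    \<open>eq\<close> its class does not depend on the choice.\<close>
  define g where "g x = R `` {f (inv_into I c x)}" for x
  have g: "g (c p) = R `` {f p}" if "p \<in> I" for p
    unfolding g_def using that by (subst eq) (auto simp: inv_into_into f_inv_into_f)
  have "inj_on g (c ` I)"
    by (auto simp: inj_on_def g eq)
  moreover have "(f ` I) // R = g ` c ` I"
    by (auto simp: quotient_def g image_image)
  ultimately show ?thesis
    by (simp add: card_image)
qed

section \<open>Sixth roots of unity\<close>

definition zeta :: complex where
  "zeta = cis (2 * pi / 6)"

lemma zeta_power: "zeta ^ k = cis (2 * pi * real k / 6)"
  by (simp add: zeta_def DeMoivre mult_ac)

lemma zeta_6: "zeta ^ 6 = 1"
  by (simp add: zeta_power)

lemma zeta_power_mod: "zeta ^ (k mod 6) = zeta ^ k"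
proof -
  have "zeta ^ k = zeta ^ (6 * (k div 6) + k mod 6)" by simp
  also have "\<dots> = zeta ^ (k mod 6)"
    by (simp only: power_add power_mult zeta_6) simp
  finally show ?thesis by simp
qed

lemma zeta_power_eq_iff: "zeta ^ a = zeta ^ b \<longleftrightarrow> a mod 6 = b mod 6"
proof
  assume "zeta ^ a = zeta ^ b"
  then have "zeta ^ (a mod 6) = zeta ^ (b mod 6)"
    by (simp add: zeta_power_mod)
  moreover have "inj_on (\<lambda>k. zeta ^ k) {..<6}"
    using bij_betw_roots_unity[of 6] by (simp add: bij_betw_def zeta_power)
  ultimately show "a mod 6 = b mod 6"
    by (auto dest: inj_onD)
qed (metis zeta_power_mod)

lemma zeta_power_mult_cnj: "zeta ^ k * cnj (zeta ^ k) = 1"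
  by (simp add: zeta_power cis_cnj cis_mult)

text \<open>Conjugation inverts \<open>zeta ^ k\<close>, and 5 is -1 modulo 6, so exponents stay
  natural numbers.\<close>

lemma cnj_zeta_power: "cnj (zeta ^ k) = zeta ^ (5 * k)"
proof -
  have "zeta ^ k * zeta ^ (5 * k) = 1"
    by (simp flip: power_add) (simp add: power_mult zeta_6)
  then show ?thesis
    by (metis zeta_power_mult_cnj mult_cancel_left mult_zero_left zero_neq_one)
qed

text \<open>The cyclotomic relation for primitive sixth roots. With the next three lemmas it reduces
  all powers to integer combinations of 1 and \<open>zeta\<close>, where sums cancel by
  arithmetic.\<close>

lemma zeta_2: "zeta ^ 2 = zeta - 1"
  by (simp add: zeta_def DeMoivre complex_eq_iff cos_60 sin_60 cos_120 sin_120)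

lemma zeta_3: "zeta ^ 3 = - 1"
  by (simp add: zeta_power)

lemma zeta_4: "zeta ^ 4 = - zeta"
  using zeta_3 by (simp add: eval_nat_numeral)

lemma zeta_5: "zeta ^ 5 = 1 - zeta"
  using zeta_3 zeta_2 by (simp add: eval_nat_numeral algebra_simps)

lemma omega_eq_zeta: "omega = zeta ^ 2"
  by (simp add: omega_def zeta_power cis_conv_exp mult_ac)

section \<open>Exponents and orthogonality of the columns\<close>

text \<open>Logarithms of the entries of \<open>H6\<close> to base \<open>zeta\<close>:
  \<open>omega\<close> has exponent 2 and -1 has exponent 3.\<close>

definition H6_exp :: "nat \<Rightarrow> nat \<Rightarrow> nat" where
  "H6_exp r i =
    [[0, 0, 0, 0, 0, 0],
     [0, 2, 4, 0, 2, 4],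
     [0, 4, 2, 2, 0, 4],
     [0, 0, 0, 3, 3, 3],
     [0, 2, 4, 3, 5, 1],
     [0, 4, 2, 5, 3, 1]] ! r ! i"

lemma less_6_cases: "(r::nat) < 6 \<longleftrightarrow> r \<in> {0, 1, 2, 3, 4, 5}"
  by auto

lemma lessThan_6: "{..<6::nat} = {0, 1, 2, 3, 4, 5}"
  by auto

lemma H6_index:
  assumes "r < 6" "i < 6"
  shows "H6 $$ (r, i) = zeta ^ H6_exp r i"
proof -
  \<comment> \<open>The entries of \<open>H6\<close> get the same normal form as the powers of
    \<open>zeta\<close>.\<close>
  have "omega = zeta - 1" "- omega = 1 - zeta"
    by (simp_all add: omega_eq_zeta zeta_2)
  moreover have "omega ^ 2 = - zeta"
    unfolding omega_eq_zeta by (simp add: zeta_4 flip: power_mult)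
  ultimately show ?thesis
    using assms
    by (auto simp: less_6_cases H6_def mat_of_rows_list_def H6_exp_def zeta_2 zeta_3 zeta_4 zeta_5)
qed

lemma H6_orthogonal:
  assumes "i < 6" "j < 6" "i \<noteq> j"
  shows "(\<Sum>r<6. zeta ^ H6_exp r i * cnj (zeta ^ H6_exp r j)) = 0"
proof -
  \<comment> \<open>Reducing modulo 6 leaves only exponents below 6, covered by
    \<open>zeta_2\<close> to \<open>zeta_5\<close>.\<close>
  have "(\<Sum>r<6. zeta ^ H6_exp r i * cnj (zeta ^ H6_exp r j)) =
    (\<Sum>r<6. zeta ^ ((H6_exp r i + 5 * H6_exp r j) mod 6))"
    by (simp add: cnj_zeta_power zeta_power_mod power_add del: complex_cnj_power)
  also have "\<dots> = 0"
    using assms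
    by (auto simp: less_6_cases lessThan_6 H6_exp_def zeta_2 zeta_3 zeta_4 zeta_5)
  finally show ?thesis .
qed

definition swap01 :: "nat \<Rightarrow> nat" where
  "swap01 = transpose 0 1"

lemma swap01_less: "r < 6 \<Longrightarrow> swap01 r < 6"
  by (auto simp: swap01_def transpose_def)

lemma K6_index:
  assumes "r < 6" "i < 6"
  shows "K6 $$ (r, i) = zeta ^ H6_exp (swap01 r) i"
  using assms H6_carrier H6_index[of 0 i] H6_index[of 1 i] H6_index[of r i]
  by (auto simp: K6_def P6_mult_H6 swap01_def transpose_def)

text \<open>The row exchange merely permutes the summands in \<open>H6_orthogonal\<close>.\<close>

lemma K6_orthogonal:
  assumes "i < 6" "j < 6" "i \<noteq> j"
  shows "(\<Sum>r<6. zeta ^ H6_exp (swap01 r) i * cnj (zeta ^ H6_exp (swap01 r) j)) = 0"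
proof -
  have "bij_betw swap01 {..<6} {..<6}"
    by (rule bij_betw_byWitness[where f' = swap01]) (auto simp: swap01_less, auto simp: swap01_def)
  from sum.reindex_bij_betw[OF this, of "\<lambda>r. zeta ^ H6_exp r i * cnj (zeta ^ H6_exp r j)"]
  show ?thesis
    using H6_orthogonal[OF assms] by simp
qed

section \<open>Inner products in the array\<close>

definition Phi27_exp :: "nat \<times> nat \<Rightarrow> nat \<Rightarrow> nat" where
  "Phi27_exp p r = H6_exp r (fst p) + H6_exp (swap01 r) (snd p)"

lemma Phi27_carrier: "Phi27 i j \<in> carrier_vec 6"
  using H6_carrier by (auto simp: Phi27_def schur_prod_def)

lemma Phi27_index:
  assumes "i < 6" "j < 6" "r < 6"
  shows "Phi27 i j $ r = complex_of_real (1 / sqrt 6) * zeta ^ Phi27_exp (i, j) r"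
proof -
  have "K6 \<in> carrier_mat 6 6"
    using H6_carrier by (simp add: K6_def P6_mult_H6)
  then show ?thesis
    using assms H6_carrier
    by (simp add: Phi27_def schur_prod_def H6_index K6_index Phi27_exp_def power_add)
qed

text \<open>Each summand is grouped into an H factor and a K factor. If i = i' or j = j', the
  corresponding factor is 1 and an inner product of columns of the other matrix remains.\<close>

lemma Phi27_inner:
  assumes "i < 6" "j < 6" "i' < 6" "j' < 6"
  shows "Phi27 i j \<bullet>c Phi27 i' j' =
    (\<Sum>r<6. (zeta ^ H6_exp r i * cnj (zeta ^ H6_exp r i')) *
      (zeta ^ H6_exp (swap01 r) j * cnj (zeta ^ H6_exp (swap01 r) j'))) / 6"
proof -
  have s: "complex_of_real (1 / sqrt 6) * cnj (complex_of_real (1 / sqrt 6)) = 1 / 6"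
    by (simp flip: of_real_mult)
  have "Phi27 i j \<bullet>c Phi27 i' j' = (\<Sum>r<6. Phi27 i j $ r * cnj (Phi27 i' j' $ r))"
    using Phi27_carrier[of i j] Phi27_carrier[of i' j']
    by (simp add: scalar_prod_def atLeast0LessThan)
  also have "\<dots> = (\<Sum>r<6. (complex_of_real (1 / sqrt 6) * cnj (complex_of_real (1 / sqrt 6))) *
      ((zeta ^ H6_exp r i * cnj (zeta ^ H6_exp r i')) *
      (zeta ^ H6_exp (swap01 r) j * cnj (zeta ^ H6_exp (swap01 r) j'))))"
    using assms by (intro sum.cong) (simp_all add: Phi27_index Phi27_exp_def power_add mult_ac)
  also have "\<dots> = (\<Sum>r<6. (zeta ^ H6_exp r i * cnj (zeta ^ H6_exp r i')) *
      (zeta ^ H6_exp (swap01 r) j * cnj (zeta ^ H6_exp (swap01 r) j'))) / 6"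
    unfolding s by (simp add: sum_divide_distrib del: complex_cnj_power)
  finally show ?thesis .
qed

lemma Phi27_unit: "i < 6 \<Longrightarrow> j < 6 \<Longrightarrow> Phi27 i j \<in> unit_sphere 6"
  unfolding unit_sphere_def using Phi27_carrier
  by (simp add: Phi27_inner zeta_power_mult_cnj del: complex_cnj_power)

lemma quantum_latin_square_Phi27: "quantum_latin_square 6 Phi27"
  unfolding quantum_latin_square_def
proof (intro conjI allI impI)
  show "orthonormal_basis 6 (Phi27 i)" if "i < 6" for i
    using that
    by (intro orthonormal_basisI)
      (simp_all add: Phi27_unit Phi27_inner zeta_power_mult_cnj K6_orthogonal
        del: complex_cnj_power)
  show "orthonormal_basis 6 (\<lambda>i. Phi27 i j)" if "j < 6" for j
    using that
    by (intro orthonormal_basisI)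
      (simp_all add: Phi27_unit Phi27_inner zeta_power_mult_cnj H6_orthogonal
        del: complex_cnj_power)
qed (rule Phi27_unit)

section \<open>Phase classes as words modulo 6\<close>

text \<open>Division by the entry with index 0 appears as addition of 5 times its exponent.\<close>

definition phase_word :: "nat \<times> nat \<Rightarrow> nat list" where
  "phase_word p = map (\<lambda>r. (Phi27_exp p r + 5 * Phi27_exp p 0) mod 6) [0..<6]"

lemma phase_rel_Phi27_iff:
  assumes p: "i < 6" "j < 6" and q: "i' < 6" "j' < 6"
  shows "(Phi27 i j, Phi27 i' j') \<in> phase_rel 6 \<longleftrightarrow> phase_word (i, j) = phase_word (i', j')"
proof
  let ?e = "Phi27_exp (i, j)" and ?e' = "Phi27_exp (i', j')"
  assume "(Phi27 i j, Phi27 i' j') \<in> phase_rel 6"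
  then obtain c where c: "Phi27 i j = c \<cdot>\<^sub>v Phi27 i' j'"
    by (auto simp: phase_rel_def)
  have *: "zeta ^ ?e r = c * zeta ^ ?e' r" if "r < 6" for r
  proof -
    have "Phi27 i j $ r = c * Phi27 i' j' $ r"
      unfolding c using that Phi27_carrier[of i' j'] by simp
    then show ?thesis using that p q by (simp add: Phi27_index)
  qed
  \<comment> \<open>Comparing sixth powers at index 0 shows that the phase \<open>c\<close> is
    itself a sixth root of unity.\<close>
  have "(zeta ^ ?e 0) ^ 6 = c ^ 6 * (zeta ^ ?e' 0) ^ 6"
    using *[of 0] by (simp add: power_mult_distrib)
  moreover have "(zeta ^ k) ^ 6 = 1" for k
    by (metis mult.commute power_mult power_one zeta_6)
  ultimately have c6: "c ^ 6 = 1" by simp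
  have "zeta ^ (?e r + 5 * ?e 0) = zeta ^ (?e' r + 5 * ?e' 0)" if "r < 6" for r
  proof -
    have "zeta ^ (?e r + 5 * ?e 0) = zeta ^ ?e r * (zeta ^ ?e 0) ^ 5"
      by (simp add: power_add mult.commute flip: power_mult)
    \<comment> \<open>One factor \<open>c\<close> comes from entry r and five from entry 0.\<close>
    also have "\<dots> = c ^ 6 * (zeta ^ ?e' r * (zeta ^ ?e' 0) ^ 5)"
      using *[OF that] *[of 0] by (simp add: power_mult_distrib eval_nat_numeral)
    also have "\<dots> = zeta ^ (?e' r + 5 * ?e' 0)"
      by (simp add: c6 power_add mult.commute flip: power_mult)
    finally show ?thesis .
  qed
  then show "phase_word (i, j) = phase_word (i', j')"
    by (simp add: phase_word_def zeta_power_eq_iff)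
next
  let ?e = "Phi27_exp (i, j)" and ?e' = "Phi27_exp (i', j')"
  assume w: "phase_word (i, j) = phase_word (i', j')"
  \<comment> \<open>Modulo 6 this is the difference of the exponents at index 0, hence the exponent
    of the relative phase.\<close>
  define k where "k = ?e 0 + 5 * ?e' 0"
  have "zeta ^ ?e r = zeta ^ k * zeta ^ ?e' r" if "r < 6" for r
  proof -
    have "(?e r + 5 * ?e 0) mod 6 = (?e' r + 5 * ?e' 0) mod 6"
      using w that by (simp add: phase_word_def)
    then have "zeta ^ (?e r + 5 * ?e 0) = zeta ^ (?e' r + 5 * ?e' 0)"
      by (simp add: zeta_power_eq_iff)
    then have "zeta ^ (?e r + 5 * ?e 0) * zeta ^ ?e 0 = zeta ^ k * zeta ^ ?e' r"
      by (simp add: k_def power_add)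
    moreover have "zeta ^ (?e r + 5 * ?e 0) * zeta ^ ?e 0 = zeta ^ ?e r"
      by (simp only: zeta_power_eq_iff flip: power_add) presburger
    ultimately show ?thesis by simp
  qed
  then have "Phi27 i j = zeta ^ k \<cdot>\<^sub>v Phi27 i' j'"
    using p q Phi27_carrier[of i j] Phi27_carrier[of i' j']
    by (intro eq_vecI) (auto simp: Phi27_index)
  moreover have "zeta ^ k = exp (\<i> * complex_of_real (2 * pi * real k / 6))"
    by (simp only: zeta_power cis_conv_exp)
  ultimately have "\<exists>\<alpha>::real. Phi27 i j = exp (\<i> * complex_of_real \<alpha>) \<cdot>\<^sub>v Phi27 i' j'"
    by metis
  then show "(Phi27 i j, Phi27 i' j') \<in> phase_rel 6"
    using Phi27_unit p q by (simp add: phase_rel_def)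
qed

lemma card_phase_words: "card (phase_word ` ({..<6} \<times> {..<6})) = 27"
proof -
  \<comment> \<open>Listing the 36 index pairs turns the cardinality into an executable count of
    distinct words.\<close>
  have "{..<6} \<times> {..<6} = set (List.product [0..<6] [0..<6])"
    by (simp add: atLeast0LessThan)
  then have "card (phase_word ` ({..<6} \<times> {..<6})) =
      length (remdups (map phase_word (List.product [0..<6] [0..<6])))"
    by (metis length_remdups_card_conv set_map)
  also have "\<dots> = 27"
    unfolding phase_word_def Phi27_exp_def H6_exp_def swap01_def by code_simp
  finally show ?thesis .
qed

theorem theorem5:
  shows "quantum_latin_square 6 Phi27 \<and> qls_cardinality 6 Phi27 = 27"
proof
  let ?I = "{..<6::nat} \<times> {..<6::nat}"
  have "{Phi27 i j | i j. i < 6 \<and> j < 6} = case_prod Phi27 ` ?I"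
    by auto
  moreover have "card ((case_prod Phi27 ` ?I) // phase_rel 6) = card (phase_word ` ?I)"
    by (rule card_quotient_image[OF equiv_phase_rel])
      (auto simp: Phi27_unit phase_rel_Phi27_iff)
  ultimately show "qls_cardinality 6 Phi27 = 27"
    by (simp add: qls_cardinality_def card_phase_words)
qed (rule quantum_latin_square_Phi27)

end
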